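(* For every $i\ge 2$, the two-sided ideal $M_i(A_2)$ is generated by the Lie relations $P=0$, $P\in\mathcal{S}_i$ (that is, $M_i(A_2)$ is the two-sided ideal of $A_2$ generated by the elements $P\in\mathcal{S}_i$). Moreover, $Q_i(A_2)=A_2/M_i(A_2)$ and $A_2/\langle\mathcal{S}_i\rangle$ are isomorphic as vector spaces.
   Context: $\mathcal{K}$ is a field of characteristic zero, and $A_2$ is the free associative unitary $\mathcal{K}$-algebra on generators $x_1,x_2$. Put $[a,b]=ab-ba$, and norm longer commutators to the right: $[a_1,a_2,\dots,a_m]=[a_1,[a_2,\dots,a_m]]$. Define $L_1(A_2)=A_2$ and, for $i\ge 2$, $L_i(A_2)=[A_2,L_{i-1}(A_2)]$ (linear span of commutators). Let $M_i(A_2)=A_2\cdot L_i(A_2)\cdot A_2$ be the two-sided ideal generated by $L_i(A_2)$. A pure commutator of length $m$ is a nonzero commutator $[x_{j_1},\dots,x_{j_m}]$ with a single generator in each slot. A pure-commutator product is a finite product of pure commutators (zero is not counted). A pure-commutator product $p$ has a maximal inclusion in $M_l(A_2)$ if $p\in M_l(A_2)$ and $p\notin M_{l+1}(A_2)$. $\mathcal{S}_i$ denotes the set of all pure-commutator products that consist of pure commutators of length at least two and have a maximal inclusion in $M_i(A_2)$, and $\langle\mathcal{S}_i\rangle$ is the two-sided ideal of $A_2$ generated by $\mathcal{S}_i$. The universal Lie nilpotent associative algebra is $Q_i(A_2)=A_2/M_i(A_2)$. *)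

theory Defs
  imports
    Complex_Main
    "HOL-Library.Poly_Mapping"
    "HOL-Algebra.Module"
    "HOL-Algebra.QuotRing"
begin

section \<open>The free associative algebra on two generators\<close>

datatype gen = X1 | X2

text \<open>
  The free monoid, written additively because multiplication of \<^typ>\<open>'a \<Rightarrow>\<^sub>0 'b\<close> is
  convolution over an additive monoid. It is a type of its own so as not to fix a class instance
  on lists.
\<close>

datatype 'a free_mon = Mon "'a list"

instantiation free_mon :: (type) monoid_add
begin

definition zero_free_mon :: "'a free_mon" where "0 = Mon []"

fun plus_free_mon :: "'a free_mon \<Rightarrow> 'a free_mon \<Rightarrow> 'a free_mon" where
  "Mon u + Mon v = Mon (u @ v)"

instance
proof
  fix a b c :: "'a free_mon"
  show "a + b + c = a + (b + c)" by (cases a; cases b; cases c) simp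
  show "0 + a = a" "a + 0 = a" by (cases a; simp add: zero_free_mon_def)+
qed

end

type_synonym 'k falg = "gen free_mon \<Rightarrow>\<^sub>0 'k"

definition gen :: "gen \<Rightarrow> 'k::field_char_0 falg" where
  "gen j = Poly_Mapping.single (Mon [j]) 1"

definition scale :: "'k::field_char_0 \<Rightarrow> 'k falg \<Rightarrow> 'k falg" where
  "scale c p = Poly_Mapping.map ((*) c) p"

lemma scale_conv_mult: "scale c p = Poly_Mapping.single 0 c * p"
  by (simp add: scale_def mult_map_scale_conv_mult)

interpretation falg: vector_space scale
  by unfold_locales
    (simp_all add: scale_conv_mult distrib_left distrib_right single_add mult_single
      flip: mult.assoc)

definition A2 :: "('k::field_char_0, 'k falg) module" where
  "A2 = \<lparr>carrier = UNIV, mult = (*), one = 1, zero = 0, add = (+), smult = scale\<rparr>"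


section \<open>Lie ideals, pure commutator products\<close>

definition lie :: "'a::ring \<Rightarrow> 'a \<Rightarrow> 'a" where
  "lie a b = a * b - b * a"

fun lie_list :: "'a::ring list \<Rightarrow> 'a" where
  "lie_list [] = 0"
| "lie_list [a] = a"
| "lie_list (a # b # as) = lie a (lie_list (b # as))"

text \<open>The index starts at \<open>1\<close>; the value at \<open>0\<close> is a dummy.\<close>

fun L :: "nat \<Rightarrow> 'k::field_char_0 falg set" where
  "L 0 = UNIV"
| "L (Suc 0) = UNIV"
| "L (Suc (Suc n)) = falg.span {lie a b | a b. b \<in> L (Suc n)}"

definition M :: "nat \<Rightarrow> 'k::field_char_0 falg set" where
  "M i = Idl\<^bsub>A2\<^esub> (L i)"

definition pure_commutators :: "nat \<Rightarrow> 'k::field_char_0 falg set" where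
  "pure_commutators m =
    {lie_list (map gen js) | js. length js = m \<and> 1 \<le> m \<and> lie_list (map gen js) \<noteq> (0 :: 'k falg)}"

definition max_inclusion :: "nat \<Rightarrow> 'k::field_char_0 falg \<Rightarrow> bool" where
  "max_inclusion l p \<longleftrightarrow> p \<in> M l \<and> p \<notin> M (l + 1)"

definition S :: "nat \<Rightarrow> 'k::field_char_0 falg set" where
  "S i = {prod_list cs | cs. cs \<noteq> [] \<and> set cs \<subseteq> (\<Union>m\<in>{2..}. pure_commutators m)
            \<and> prod_list cs \<noteq> 0 \<and> max_inclusion i (prod_list cs)}"


section \<open>Quotient algebras and isomorphism of vector spaces\<close>

text \<open>
  The quotient ring carries the scalar multiplication sending \<open>c\<close> and the coset of \<open>x\<close> to the
  coset of \<open>c x\<close>. The union runs over all representatives of the coset; its members coincide when \<open>I\<close>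
  is a two-sided ideal, and forming \<open>I + c x\<close> rather than \<open>c x\<close> is needed for \<open>c = 0\<close>.
\<close>

definition quot_alg :: "('k, 'a, 'm) module_scheme \<Rightarrow> 'a set \<Rightarrow> ('k, 'a set) module" where
  "quot_alg A I = ring.extend (A Quot I)
     (module.fields (\<lambda>c X. \<Union>x\<in>X. I +>\<^bsub>A\<^esub> (c \<odot>\<^bsub>A\<^esub> x)))"

definition Q :: "nat \<Rightarrow> ('k::field_char_0, 'k falg set) module" where
  "Q i = quot_alg A2 (M i)"

text \<open>Here the scalars are the whole type \<^typ>\<open>'k\<close>.\<close>

definition vs_isomorphic :: "('k, 'a, 'm) module_scheme \<Rightarrow> ('k, 'b, 'n) module_scheme \<Rightarrow> bool" where
  "vs_isomorphic V W \<longleftrightarrow>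
    (\<exists>h \<in> iso (add_monoid V) (add_monoid W).
       \<forall>c. \<forall>v \<in> carrier V. h (c \<odot>\<^bsub>V\<^esub> v) = c \<odot>\<^bsub>W\<^esub> h v)"


section \<open>Well-definedness\<close>

lemma A2_simps [simp]:
  "carrier A2 = UNIV" "mult A2 = (*)" "one A2 = 1" "zero A2 = 0" "add A2 = (+)" "smult A2 = scale"
  by (simp_all add: A2_def)

lemma ring_A2: "ring (A2 :: ('k::field_char_0, 'k falg) module)"
proof (rule ringI)
  show "abelian_group (A2 :: ('k, 'k falg) module)"
    by (rule abelian_groupI) (auto simp: add_ac intro: exI [of _ "- _"] left_minus)
  show "Group.monoid (A2 :: ('k, 'k falg) module)"
    by (rule Group.monoidI) (auto simp: mult.assoc)
qed (auto simp: distrib_left distrib_right)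

lemma ideal_M: "ideal (M i :: 'k::field_char_0 falg set) A2"
  unfolding M_def by (rule ring.genideal_ideal [OF ring_A2]) simp

lemma quot_alg_simps [simp]:
  "carrier (quot_alg A I) = a_rcosets\<^bsub>A\<^esub> I"
  "mult (quot_alg A I) = rcoset_mult A I"
  "one (quot_alg A I) = I +>\<^bsub>A\<^esub> \<one>\<^bsub>A\<^esub>"
  "zero (quot_alg A I) = I"
  "add (quot_alg A I) = set_add A"
  "smult (quot_alg A I) = (\<lambda>c X. \<Union>x\<in>X. I +>\<^bsub>A\<^esub> (c \<odot>\<^bsub>A\<^esub> x))"
  by (simp_all add: quot_alg_def ring.extend_def module.fields_def FactRing_def)

lemma quot_alg_smult_coset:
  fixes I :: "'k::field_char_0 falg set"
  assumes "ideal I A2"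
  shows "c \<odot>\<^bsub>quot_alg A2 I\<^esub> (I +>\<^bsub>A2\<^esub> x) = I +>\<^bsub>A2\<^esub> scale c x"
proof -
  interpret ideal I A2 by fact
  have z: "0 \<in> I"
    using additive_subgroup.zero_closed [OF is_additive_subgroup] by simp
  have add: "a + b \<in> I" if "a \<in> I" "b \<in> I" for a b
    using additive_subgroup.a_closed [OF is_additive_subgroup that] by simp
  have sc: "scale c a \<in> I" if "a \<in> I" for a
    using I_l_closed [OF that, of "Poly_Mapping.single 0 c"] by (simp add: scale_conv_mult)
  have coset: "I +>\<^bsub>A2\<^esub> y = {a + y | a. a \<in> I}" for y
    by (auto simp: a_r_coset_def r_coset_def)
  have "{b + scale c (a + x) | a b. a \<in> I \<and> b \<in> I} = {a + scale c x | a. a \<in> I}"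
    (is "?l = ?r")
  proof
    show "?l \<subseteq> ?r"
    proof
      fix y assume "y \<in> ?l"
      then obtain a b where "y = (b + scale c a) + scale c x" "a \<in> I" "b \<in> I"
        by (auto simp: falg.scale_right_distrib add.assoc)
      then show "y \<in> ?r" using add sc by blast
    qed
    show "?r \<subseteq> ?l"
    proof
      fix y assume "y \<in> ?r"
      then obtain b where b: "b \<in> I" "y = b + scale c (0 + x)" by auto
      then show "y \<in> ?l" using z by blast
    qed
  qed
  moreover have "(\<Union>y\<in>{a + x | a. a \<in> I}. {b + scale c y | b. b \<in> I})
      = {b + scale c (a + x) | a b. a \<in> I \<and> b \<in> I}"
    by blast
  ultimately show ?thesis by (simp add: coset)
qed

end

(*
  Give a product of pure commutators of lengths l_1, ..., l_r the weight (l_1 - 1) + ... + (l_r - 1).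
  On two generators M_j M_k is contained in M_{j+k-1} for all j and k: modulo M_{k+1} the expression
  [a, b] [c, w] with w in L_{k-1} is an alternating derivation in a, b, c, hence zero, which gives
  j = 2, and [a, t] y = [a, t y] - t [a, y] gives the induction on j. So products of weight m lie in
  M_{m+1}; conversely M_{m+1} lies in the ideal spanned by the products of weight at least m. A
  product of weight m + 1 is generated by products of weight m and smaller degree, so the products of
  weight exactly m generate M_{m+1}. If such a product also lies in M_{m+2}, then, being homogeneous,
  it is generated by products of weight m and smaller degree, so by induction on the degree those
  outside M_{m+2} suffice.
*)

theory Submission
  imports Defs
begin

section \<open>Ideals and induction in the free algebra\<close>

lemma ideal_A2_iff:
  fixes I :: "'k::field_char_0 falg set"
  shows "ideal I A2 \<longleftrightarrow>
    0 \<in> I \<and> (\<forall>x\<in>I. \<forall>y\<in>I. x + y \<in> I) \<and> (\<forall>x\<in>I. \<forall>a. a * x \<in> I \<and> x * a \<in> I)"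
    (is "_ \<longleftrightarrow> ?closed")
proof
  assume "ideal I A2"
  then interpret ideal I A2 .
  show ?closed
    using additive_subgroup.zero_closed [OF is_additive_subgroup]
      additive_subgroup.a_closed [OF is_additive_subgroup] I_l_closed I_r_closed
    by simp
next
  assume c: ?closed
  interpret A: ring "A2 :: ('k, 'k falg) module" by (rule ring_A2)
  have neg: "\<ominus>\<^bsub>A2\<^esub> x = - x" for x :: "'k falg"
    by (rule A.minus_equality) simp_all
  have "- x \<in> I" if "x \<in> I" for x
    using c that by (metis mult_minus1)
  then have "subgroup I (add_monoid A2)"
    using c neg by (intro A.add.subgroupI) (auto simp: a_inv_def [symmetric])
  then show "ideal I A2"
    using c by (intro idealI ring_A2) simp_all
qed

lemma
  fixes I :: "'k::field_char_0 falg set"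
  assumes I: "ideal I A2"
  shows ideal_zero: "0 \<in> I"
    and ideal_add: "x \<in> I \<Longrightarrow> y \<in> I \<Longrightarrow> x + y \<in> I"
    and ideal_mult_left: "x \<in> I \<Longrightarrow> a * x \<in> I"
    and ideal_mult_right: "x \<in> I \<Longrightarrow> x * a \<in> I"
  using I unfolding ideal_A2_iff by blast+

lemma
  fixes I :: "'k::field_char_0 falg set"
  assumes I: "ideal I A2"
  shows ideal_scale: "x \<in> I \<Longrightarrow> scale c x \<in> I"
    and ideal_uminus: "x \<in> I \<Longrightarrow> - x \<in> I"
    and ideal_diff: "x \<in> I \<Longrightarrow> y \<in> I \<Longrightarrow> x - y \<in> I"
proof -
  show "scale c x \<in> I" if "x \<in> I" for c x
    using ideal_mult_left [OF I that] by (simp add: scale_conv_mult)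
  show uminus: "- x \<in> I" if "x \<in> I" for x
    using ideal_mult_left [OF I that, of "-1"] by simp
  show "x - y \<in> I" if "x \<in> I" "y \<in> I" for x y
    using ideal_add [OF I that(1) uminus [OF that(2)]] by simp
qed

lemma subspace_ideal: "ideal I A2 \<Longrightarrow> falg.subspace I"
  by (simp add: falg.subspace_def ideal_zero ideal_add ideal_scale)

lemma Idl_A2_minimal: "ideal I A2 \<Longrightarrow> X \<subseteq> I \<Longrightarrow> Idl\<^bsub>A2\<^esub> X \<subseteq> I"
  by (rule ring.genideal_minimal [OF ring_A2])

lemma Idl_A2_self: "X \<subseteq> Idl\<^bsub>A2\<^esub> X"
  by (rule ring.genideal_self [OF ring_A2]) simp

lemma ideal_Idl_A2: "ideal (Idl\<^bsub>A2\<^esub> X) A2"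
  by (rule ring.genideal_ideal [OF ring_A2]) simp

section \<open>Expansion into words, and the induction principle it yields\<close>

lemma poly_mapping_sum_monomials:
  "(\<Sum>k\<in>Poly_Mapping.keys p. Poly_Mapping.single k (Poly_Mapping.lookup p k)) = p"
  by (rule poly_mapping_eqI) (simp add: lookup_sum lookup_single when_def in_keys_iff if_distrib cong: if_cong)

lemma scale_mult_left: "scale c p * q = scale c (p * q)"
  by (simp add: scale_conv_mult mult.assoc)

text \<open>Scalars are central: a constant sits at the neutral monomial and coefficients commute,
  so the claim holds monomial by monomial.\<close>

lemma mult_scale_right:
  fixes p q :: "'k::field_char_0 falg"
  shows "p * scale c q = scale c (p * q)"
proof -
  have "p * Poly_Mapping.single 0 c = Poly_Mapping.single 0 c * p"
    by (subst (1 2) poly_mapping_sum_monomials [symmetric])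
      (simp add: sum_distrib_left sum_distrib_right mult_single mult.commute)
  then show ?thesis
    by (simp add: scale_conv_mult flip: mult.assoc)
qed

abbreviation word :: "gen list \<Rightarrow> 'k::field_char_0 falg" where
  "word w \<equiv> Poly_Mapping.single (Mon w) 1"

lemma word_Nil: "word [] = 1"
  by (simp flip: zero_free_mon_def)

lemma word_append: "word (u @ v) = word u * word v"
  by (simp add: mult_single)

lemma word_Cons: "word (g # w) = gen g * word w"
  by (simp add: gen_def mult_single)

text \<open>Words are products of generators and span the algebra. This is how derivation identities
  are later reduced to generators.\<close>

lemma falg_induct [case_names one gen add scale mult]:
  fixes p :: "'k::field_char_0 falg"
  assumes "P 1" and "\<And>g. P (gen g)"
    and add: "\<And>p q. P p \<Longrightarrow> P q \<Longrightarrow> P (p + q)"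
    and scale: "\<And>c p. P p \<Longrightarrow> P (scale c p)"
    and mult: "\<And>p q. P p \<Longrightarrow> P q \<Longrightarrow> P (p * q)"
  shows "P p"
proof -
  have word: "P (word w)" for w
  proof (induction w)
    case Nil
    show ?case using assms(1) by (simp only: word_Nil)
  next
    case (Cons g w)
    then show ?case using assms(2) mult by (simp only: word_Cons)
  qed
  have zero: "P 0"
    using scale [OF assms(1), of 0] by (simp only: falg.scale_zero_left)
  have "P (\<Sum>k\<in>K. Poly_Mapping.single k (Poly_Mapping.lookup p k))" if "finite K" for K :: "gen free_mon set"
    using that
  proof (induction K)
    case empty
    show ?case using zero by simp
  next
    case (insert k K)
    obtain w where "k = Mon w" by (cases k)
    then have "Poly_Mapping.single k (Poly_Mapping.lookup p k) = scale (Poly_Mapping.lookup p k) (word w)"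
      by (simp add: scale_conv_mult mult_single)
    then show ?case
      using insert add scale [OF word] by simp
  qed
  then show ?thesis
    using poly_mapping_sum_monomials [of p] by (metis finite_keys)
qed

section \<open>Products of the ideals\<close>

lemma lie_add_left: "lie (a + b) c = lie a c + lie b c"
  and lie_add_right: "lie a (b + c) = lie a b + lie a c"
  and lie_mult_left: "lie (a * b) c = a * lie b c + lie a c * b"
  and lie_mult_right: "lie a (b * c) = lie a b * c + b * lie a c"
  and lie_0_right: "lie a 0 = 0"
  and lie_skew: "lie a b = - lie b a"
  and lie_self: "lie a a = 0"
  for a b c :: "'a::ring"
  by (simp_all add: lie_def algebra_simps)

lemma lie_1_left: "lie 1 a = 0"
  for a :: "'a::ring_1"
  by (simp add: lie_def)

lemma lie_scale_left: "lie (scale c a) b = scale c (lie a b)"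
  and lie_scale_right: "lie a (scale c b) = scale c (lie a b)"
  by (simp_all add: lie_def scale_mult_left mult_scale_right falg.scale_right_diff_distrib)

section \<open>The spaces \<open>L\<close> and the ideals \<open>M\<close>\<close>

lemma subspace_L: "falg.subspace (L n)"
  by (induction n rule: L.induct) simp_all

lemma lie_in_L: "b \<in> L (Suc n) \<Longrightarrow> lie a b \<in> L (Suc (Suc n))"
  by (auto intro!: falg.span_base)

lemma L_Suc_induct [consumes 1, case_names lie zero add scale]:
  assumes "x \<in> L (Suc (Suc n))"
    and "\<And>a b. b \<in> L (Suc n) \<Longrightarrow> P (lie a b)"
    and "P 0" "\<And>x y. P x \<Longrightarrow> P y \<Longrightarrow> P (x + y)" "\<And>c x. P x \<Longrightarrow> P (scale c x)"
  shows "P x"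
proof -
  have "falg.subspace (Collect P)"
    using assms(3-) by (simp add: falg.subspace_def)
  then have "L (Suc (Suc n)) \<subseteq> Collect P"
    using assms(2) unfolding L.simps by (intro falg.span_minimal) auto
  then show ?thesis using assms(1) by blast
qed

lemma L_Suc_subset: "L (Suc n) \<subseteq> (L n :: 'k::field_char_0 falg set)"
proof (induction n)
  case (Suc n)
  show ?case
  proof
    fix x :: "'k falg" assume "x \<in> L (Suc (Suc n))"
    then show "x \<in> L (Suc n)"
    proof (induction rule: L_Suc_induct)
      case (lie a b)
      then show ?case using Suc.IH by (cases n) (auto simp del: L.simps(3) intro: lie_in_L)
    qed (use subspace_L in \<open>auto intro: falg.subspace_0 falg.subspace_add falg.subspace_scale\<close>)
  qed
qed simp

lemma L_subset_M: "L n \<subseteq> M n"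
  unfolding M_def by (rule Idl_A2_self)

lemma M_minimal: "ideal I A2 \<Longrightarrow> L n \<subseteq> I \<Longrightarrow> M n \<subseteq> I"
  unfolding M_def by (rule Idl_A2_minimal)

lemmas M_zero = ideal_zero [OF ideal_M]
  and M_add = ideal_add [OF ideal_M]
  and M_diff = ideal_diff [OF ideal_M]
  and M_uminus = ideal_uminus [OF ideal_M]
  and M_scale = ideal_scale [OF ideal_M]
  and M_mult_left = ideal_mult_left [OF ideal_M]
  and M_mult_right = ideal_mult_right [OF ideal_M]

lemma M_1: "M (Suc 0) = UNIV"
  using L_subset_M [of "Suc 0"] by auto

text \<open>Reduces a product rule for ideals to their Lie generators. A multiplier between the two
  factors moves to the right at the cost of \<open>x * lie a z\<close>, where \<open>lie a z\<close>
  stays in \<open>L (Suc k)\<close>.\<close>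

lemma M_times_M:
  fixes x y :: "'k::field_char_0 falg"
  assumes LL: "\<And>x y :: 'k falg. x \<in> L j \<Longrightarrow> y \<in> L (Suc k) \<Longrightarrow> x * y \<in> M n"
    and "x \<in> M j" and "y \<in> M (Suc k)"
  shows "x * y \<in> M n"
proof -
  have LM: "x * z \<in> M n" if "x \<in> L j" "z \<in> M (Suc k)" for x z :: "'k falg"
  proof -
    \<comment> \<open>The arbitrary middle factor \<open>a\<close> makes this set closed under left
      multiplication.\<close>
    have "ideal {z. \<forall>a. x * a * z \<in> M n} A2"
      unfolding ideal_A2_iff
    proof (intro conjI ballI allI)
      fix z b assume z: "z \<in> {z. \<forall>a. x * a * z \<in> M n}"
      then have "x * (a * b) * z \<in> M n" for a by blast
      then show "b * z \<in> {z. \<forall>a. x * a * z \<in> M n}" by (simp add: mult.assoc)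
      show "z * b \<in> {z. \<forall>a. x * a * z \<in> M n}"
        using z by (simp add: M_mult_right flip: mult.assoc)
    qed (simp_all add: M_zero distrib_left M_add)
    moreover have "x * a * z \<in> M n" if "z \<in> L (Suc k)" for a z
    proof -
      have "lie a z \<in> L (Suc k)"
        using that L_Suc_subset by (blast dest: lie_in_L)
      then have "x * z * a + x * lie a z \<in> M n"
        using LL [OF \<open>x \<in> L j\<close>] that by (blast intro: M_add M_mult_right)
      then show ?thesis by (simp add: lie_def algebra_simps)
    qed
    ultimately have "M (Suc k) \<subseteq> {z. \<forall>a. x * a * z \<in> M n}"
      by (intro M_minimal) auto
    with that(2) have "x * 1 * z \<in> M n" by blast
    then show ?thesis by simp
  qed
  have "ideal {x :: 'k falg. \<forall>y\<in>M (Suc k). x * y \<in> M n} A2"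
    unfolding ideal_A2_iff
    by (auto simp: M_zero distrib_right M_add M_mult_left mult.assoc)
  then have "M j \<subseteq> {x :: 'k falg. \<forall>y\<in>M (Suc k). x * y \<in> M n}"
    using LM by (intro M_minimal) auto
  with assms(2,3) show ?thesis by blast
qed

text \<open>
  Modulo \<open>M (k + 1)\<close>, the expression \<open>[a, b] [c, w]\<close> is alternating in \<open>a\<close>, \<open>b\<close>, \<open>c\<close>
  and a derivation in each of them. Hence it vanishes, as there are only two generators.
\<close>

lemma lie_lie_alternating:
  assumes w: "w \<in> L (Suc n)"
  shows "lie a b * lie c w + lie a c * lie b w \<in> M (Suc (Suc (Suc n)))"
proof -
  let ?M = "M (Suc (Suc (Suc n)))"
  have M: "lie p (lie q w) \<in> ?M" for p q
    using L_subset_M lie_in_L [OF lie_in_L [OF w]] by blast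
  \<comment> \<open>By the Leibniz rule the first three terms leave
    \<open>[a, b] [c, w] + [b, w] [a, c]\<close>; the last one swaps the second product. Each
    bracket is a double bracket ending in \<open>w\<close>.\<close>
  have "lie a (lie (b * c) w) - b * lie a (lie c w) - lie a (lie b w) * c
    + lie (lie a c) (lie b w) \<in> ?M"
    by (intro M_add M_diff M_mult_left M_mult_right M)
  then show ?thesis
    by (simp add: lie_def algebra_simps)
qed

lemma lie_times_lie_gen:
  assumes w: "w \<in> L (Suc n)"
  shows "lie (gen f) (gen g) * lie (gen h) w \<in> M (Suc (Suc (Suc n)))"
proof -
  let ?M = "M (Suc (Suc (Suc n)))"
  \<comment> \<open>For \<open>c = b\<close> the two alternating summands coincide; characteristic
    zero permits halving.\<close>
  have 1: "lie a b * lie b w \<in> ?M" for a b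
  proof -
    have "scale (1/2) (lie a b * lie b w + lie a b * lie b w) \<in> ?M"
      by (intro M_scale lie_lie_alternating w)
    then show ?thesis by (simp add: falg.scale_right_distrib flip: falg.scale_left_distrib)
  qed
  have 2: "lie b a * lie b w \<in> ?M" for a b
    using M_uminus [OF 1 [of a b]] by (subst lie_skew) simp
  \<comment> \<open>Two of \<open>f\<close>, \<open>g\<close>, \<open>h\<close> must coincide: this
    is where having only two generators enters.\<close>
  show ?thesis
    using 1 2 by (cases f; cases g; cases h) (simp_all add: lie_self M_zero)
qed

text \<open>Extends the vanishing from generators to all elements by the Leibniz rule, in
  \<open>c\<close>, then \<open>b\<close>, then \<open>a\<close>.\<close>

lemma lie_times_lie:
  assumes w: "w \<in> L (Suc n)"
  shows "lie a b * lie c w \<in> M (Suc (Suc (Suc n)))"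
proof -
  let ?M = "M (Suc (Suc (Suc n)))"
  \<comment> \<open>Modulo \<open>?M\<close> the bracket \<open>lie c w\<close> is central, so a
    factor \<open>p\<close> may be inserted before it.\<close>
  have comm: "x * p * lie c w \<in> ?M" if "x * lie c w \<in> ?M" for x p c
  proof -
    have "lie p (lie c w) \<in> ?M"
      using L_subset_M lie_in_L [OF lie_in_L [OF w]] by blast
    then have "x * lie c w * p + x * lie p (lie c w) \<in> ?M"
      using that by (blast intro: M_add M_mult_left M_mult_right)
    then show ?thesis by (simp add: lie_def algebra_simps)
  qed
  note simps = lie_add_left lie_add_right lie_scale_left lie_scale_right lie_mult_left
    lie_mult_right distrib_left distrib_right scale_mult_left mult_scale_right
  have 1: "lie (gen f) (gen g) * lie c w \<in> ?M" for f g c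
  proof (induction c rule: falg_induct)
    case one
    show ?case by (simp add: lie_1_left M_zero)
  next
    case (gen h)
    show ?case by (rule lie_times_lie_gen [OF w])
  next
    case (mult p q)
    then show ?case by (auto simp: simps intro: M_add comm M_mult_right simp flip: mult.assoc)
  qed (simp_all add: simps M_add M_scale)
  have 2: "lie (gen f) b * lie c w \<in> ?M" for f b
  proof (induction b rule: falg_induct)
    case one
    show ?case by (simp add: lie_def M_zero)
  next
    case (mult p q)
    then have "p * (lie (gen f) q * lie c w) + lie (gen f) p * q * lie c w \<in> ?M"
      by (blast intro: M_add M_mult_left comm)
    then show ?case by (simp add: simps mult.assoc add_ac)
  qed (simp_all add: simps M_add M_scale 1)
  show ?thesis
  proof (induction a rule: falg_induct)
    case one
    show ?case by (simp add: lie_1_left M_zero)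
  next
    case (mult p q)
    then have "p * (lie q b * lie c w) + lie p b * q * lie c w \<in> ?M"
      by (blast intro: M_add M_mult_left comm)
    then show ?case by (simp add: simps mult.assoc add_ac)
  qed (simp_all add: simps M_add M_scale 2)
qed

text \<open>By bilinearity only \<open>[a, b] [c, w]\<close> matters if \<open>k\<close> is
  positive; for \<open>k = 0\<close> the ideal property suffices.\<close>

lemma M_2_times_M:
  assumes "x \<in> M (Suc (Suc 0))" "y \<in> M (Suc k)"
  shows "x * y \<in> M (Suc (Suc k))"
proof (rule M_times_M [OF _ assms])
  fix x y :: "'a falg"
  assume x: "x \<in> L (Suc (Suc 0))" and y: "y \<in> L (Suc k)"
  show "x * y \<in> M (Suc (Suc k))"
  proof (cases k)
    case 0
    then show ?thesis using x L_subset_M M_mult_right by blast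
  next
    case (Suc n)
    have "lie a b * y \<in> M (Suc (Suc k))" for a b
      using y unfolding Suc
    proof (induction rule: L_Suc_induct)
      case (lie c w)
      then show ?case by (rule lie_times_lie)
    qed (simp_all add: M_zero distrib_left M_add mult_scale_right M_scale)
    with x show ?thesis
      by (induction rule: L_Suc_induct)
        (simp_all add: M_zero distrib_right M_add scale_mult_left M_scale)
  qed
qed

text \<open>On \<open>L\<close> a bracket raises the index by definition; on the generated ideal the
  extra Leibniz terms are absorbed by \<open>M_2_times_M\<close>.\<close>

lemma lie_in_M:
  assumes "x \<in> M (Suc n)"
  shows "lie a x \<in> (M (Suc (Suc n)) :: 'k::field_char_0 falg set)"
proof -
  let ?I = "{x \<in> M (Suc n). \<forall>a. lie a x \<in> M (Suc (Suc n))} :: 'k falg set"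
  have lie: "lie a b \<in> M (Suc (Suc 0))" for a b :: "'k falg"
    using lie_in_L [of b 0 a] L_subset_M by (metis L.simps(2) UNIV_I subsetD)
  have "ideal ?I A2"
    unfolding ideal_A2_iff
  proof (intro conjI ballI allI)
    show "0 \<in> ?I"
      by (simp add: M_zero lie_0_right)
    show "x + y \<in> ?I" if "x \<in> ?I" "y \<in> ?I" for x y
      using that by (simp add: lie_add_right M_add)
    fix x b assume x: "x \<in> ?I"
    have "lie a (b * x) \<in> M (Suc (Suc n))" for a
      unfolding lie_mult_right using x by (intro M_add M_2_times_M M_mult_left lie) auto
    then show "b * x \<in> ?I"
      using x M_mult_left by blast
    \<comment> \<open>\<open>M_2_times_M\<close> needs the commutator on the left, so
      \<open>x [a, b]\<close> is rewritten as \<open>[a, b] x - [[a, b], x]\<close>.\<close>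
    have "lie a x * b + lie a b * x - lie (lie a b) x \<in> M (Suc (Suc n))" for a
      using x by (intro M_add M_diff M_2_times_M M_mult_right lie) auto
    then have "lie a (x * b) \<in> M (Suc (Suc n))" for a
      by (simp add: lie_def algebra_simps)
    then show "x * b \<in> ?I"
      using x M_mult_right by blast
  qed
  moreover have "L (Suc n) \<subseteq> ?I"
    using L_subset_M lie_in_L by blast
  ultimately have "M (Suc n) \<subseteq> ?I"
    by (rule M_minimal)
  with assms show ?thesis by blast
qed

text \<open>The indices are shifted by one so that weights simply add.\<close>

lemma M_mult:
  assumes "x \<in> M (Suc j)" "y \<in> M (Suc k)"
  shows "x * y \<in> M (Suc (j + k))"
  using assms
proof (induction j arbitrary: k x y)
  case 0
  then show ?case by (simp add: M_mult_left)
next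
  case (Suc j)
  show ?case
  proof (rule M_times_M [OF _ Suc.prems])
    fix x y :: "'a falg"
    assume x: "x \<in> L (Suc (Suc j))" and "y \<in> L (Suc k)"
    then have y: "y \<in> M (Suc k)" using L_subset_M by blast
    from x show "x * y \<in> M (Suc (Suc j + k))"
    proof (induction rule: L_Suc_induct)
      case (lie a t)
      then have t: "t \<in> M (Suc j)" using L_subset_M by blast
      \<comment> \<open>The induction hypothesis is used at \<open>Suc k\<close> here and at
        \<open>k\<close> for \<open>t * y\<close> below, hence the generalization over
        \<open>k\<close>.\<close>
      have "t * lie a y \<in> M (Suc (j + Suc k))"
        by (intro Suc.IH t lie_in_M y)
      then have "lie a (t * y) - t * lie a y \<in> M (Suc (Suc j + k))"
        using lie_in_M [OF Suc.IH [OF t y]] by (intro M_diff) simp_all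
      then show ?case by (simp add: lie_mult_right)
    qed (simp_all add: M_zero distrib_right M_add scale_mult_left M_scale)
  qed
qed

section \<open>Products of pure commutators\<close>

abbreviation comm :: "gen list \<Rightarrow> 'k::field_char_0 falg" where
  "comm js \<equiv> lie_list (map gen js)"

text \<open>
  In \<open>pc_prod n d p\<close>, a commutator of length \<open>l \<ge> 2\<close> contributes \<open>l - 1\<close> to the weight \<open>n\<close>
  and \<open>l\<close> to the degree \<open>d\<close> of the product \<open>p\<close>, which may be zero.
\<close>

inductive pc_prod :: "nat \<Rightarrow> nat \<Rightarrow> 'k::field_char_0 falg \<Rightarrow> bool" where
  Nil: "pc_prod 0 0 1"
| Cons: "pc_prod n d p \<Longrightarrow>
    pc_prod (Suc (length js) + n) (Suc (Suc (length js)) + d) (comm (a # b # js) * p)"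

lemma pc_prod_mult:
  assumes "pc_prod m d p" "pc_prod n e q"
  shows "pc_prod (m + n) (d + e) (p * q)"
  using assms
proof (induction rule: pc_prod.induct)
  case (Cons m d p js a b)
  from pc_prod.Cons [OF Cons.IH [OF Cons.prems], of js a b] show ?case
    by (simp add: add_ac mult.assoc)
qed simp

text \<open>Passes to the factor lists used in \<open>S\<close>; nonzero weight excludes the empty
  list.\<close>

lemma pc_prod_factors:
  assumes "pc_prod n d p"
  obtains cs where "p = prod_list cs" "set cs \<subseteq> {comm js | js. 2 \<le> length js}" "n \<noteq> 0 \<Longrightarrow> cs \<noteq> []"
  using assms
proof (induction arbitrary: thesis rule: pc_prod.induct)
  case Nil
  show ?case by (rule Nil [of "[]"]) simp_all
next
  case (Cons n d p js a b)
  obtain cs where "p = prod_list cs" "set cs \<subseteq> {comm js | js. 2 \<le> length js}"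
    by (rule Cons.IH)
  then show ?case
    by (intro Cons.prems [of "comm (a # b # js) # cs"]) (auto intro!: exI [of _ "a # b # js"])
qed

lemma lie_list_in_L: "lie_list (a # as) \<in> L (Suc (length as))"
proof (induction as arbitrary: a)
  case (Cons b as)
  then show ?case by (simp del: L.simps(3) add: lie_in_L)
qed simp

lemma pc_prod_in_M: "pc_prod n d p \<Longrightarrow> p \<in> M (Suc n)"
proof (induction rule: pc_prod.induct)
  case Nil
  show ?case by (simp add: M_1)
next
  case (Cons n d p js a b)
  have "comm (a # b # js) \<in> L (Suc (Suc (length js)))"
    using lie_list_in_L [of "gen a" "map gen (b # js)"] by (simp del: L.simps(3) lie_list.simps)
  then have "comm (a # b # js) \<in> M (Suc (Suc (length js)))"
    using L_subset_M by blast
  from M_mult [OF this Cons.IH] show ?case by simp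
qed

lemma mult_span_left:
  assumes "x \<in> falg.span X" and "falg.subspace V" and "\<And>y. y \<in> X \<Longrightarrow> c * y \<in> V"
  shows "c * x \<in> V"
proof -
  have "falg.subspace {x. c * x \<in> V}"
    using assms(2) by (simp add: falg.subspace_def distrib_left mult_scale_right)
  then have "falg.span X \<subseteq> {x. c * x \<in> V}"
    using assms(3) by (intro falg.span_minimal) auto
  with assms(1) show ?thesis by blast
qed

text \<open>By the Leibniz rule the bracket lengthens one factor at a time, and a right-normed
  commutator bracketed by a generator on the left is again pure.\<close>

lemma lie_gen_pc_prod:
  "pc_prod n d p \<Longrightarrow> lie (gen g) p \<in> falg.span {q. pc_prod (Suc n) (Suc d) q}"
proof (induction rule: pc_prod.induct)
  case Nil
  show ?case by (simp add: lie_def falg.span_zero)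
next
  case (Cons n d p js a b)
  have "comm (g # a # b # js) * p \<in>
      falg.span {q. pc_prod (Suc (Suc (length js) + n)) (Suc (Suc (Suc (length js)) + d)) q}"
    using pc_prod.Cons [OF Cons.hyps, of "b # js" g a] by (intro falg.span_base) simp
  moreover have "comm (a # b # js) * lie (gen g) p \<in>
      falg.span {q. pc_prod (Suc (Suc (length js) + n)) (Suc (Suc (Suc (length js)) + d)) q}"
    using Cons.IH
  proof (rule mult_span_left)
    fix q assume "q \<in> {q. pc_prod (Suc n) (Suc d) q}"
    then have "pc_prod (Suc (length js) + Suc n) (Suc (Suc (length js)) + Suc d) (comm (a # b # js) * q)"
      by (intro pc_prod.Cons) simp
    then show "comm (a # b # js) * q \<in>
        falg.span {q. pc_prod (Suc (Suc (length js) + n)) (Suc (Suc (Suc (length js)) + d)) q}"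
      by (intro falg.span_base) simp
  qed simp
  ultimately show ?case
    by (simp add: lie_mult_right falg.span_add)
qed

lemma prod_list_zero: "0 \<in> set cs \<Longrightarrow> prod_list cs = 0"
  for cs :: "'a::semiring_1 list"
  by (induction cs) auto

section \<open>The weight filtration\<close>

text \<open>Words on the left are enough to span a two-sided ideal: moving a generator across a
  product from the right only creates products of higher weight.\<close>

definition wt_ideal :: "nat \<Rightarrow> 'k::field_char_0 falg set" where
  "wt_ideal m = falg.span {word w * p | w p n d. pc_prod n d p \<and> m \<le> n}"

lemma subspace_wt_ideal [simp]: "falg.subspace (wt_ideal m)"
  by (simp add: wt_ideal_def)

lemma wt_ideal_base: "pc_prod n d p \<Longrightarrow> m \<le> n \<Longrightarrow> word w * p \<in> wt_ideal m"
  unfolding wt_ideal_def by (rule falg.span_base) blast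

lemma pc_prod_in_wt_ideal: "pc_prod n d p \<Longrightarrow> m \<le> n \<Longrightarrow> p \<in> wt_ideal m"
  using wt_ideal_base [of n d p m "[]"] by (simp add: word_Nil)

lemma wt_ideal_induct [consumes 1, case_names subspace base]:
  assumes "x \<in> wt_ideal m" "falg.subspace {x. P x}"
    and "\<And>w p n d. pc_prod n d p \<Longrightarrow> m \<le> n \<Longrightarrow> P (word w * p)"
  shows "P x"
proof -
  have "wt_ideal m \<subseteq> {x. P x}"
    unfolding wt_ideal_def using assms(2,3) by (intro falg.span_minimal) auto
  with assms(1) show ?thesis by blast
qed

lemmas wt_ideal_zero = falg.subspace_0 [OF subspace_wt_ideal]
  and wt_ideal_add = falg.subspace_add [OF subspace_wt_ideal]
  and wt_ideal_diff = falg.subspace_diff [OF subspace_wt_ideal]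
  and wt_ideal_scale = falg.subspace_scale [OF subspace_wt_ideal]

lemma gen_times_wt_ideal: "x \<in> wt_ideal m \<Longrightarrow> gen g * x \<in> wt_ideal m"
proof (induction rule: wt_ideal_induct)
  case subspace
  show ?case
    by (simp add: falg.subspace_def wt_ideal_zero distrib_left wt_ideal_add mult_scale_right
        wt_ideal_scale)
next
  case (base w p n d)
  then have "word (g # w) * p \<in> wt_ideal m"
    by (rule wt_ideal_base)
  then show ?case by (simp only: word_Cons mult.assoc)
qed

lemma word_times_lie_gen_pc_prod:
  assumes "pc_prod n d p" "m \<le> Suc n"
  shows "word w * lie (gen g) p \<in> wt_ideal m"
  using lie_gen_pc_prod [OF assms(1)]
  by (rule mult_span_left) (use assms(2) in \<open>auto intro: wt_ideal_base\<close>)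

lemma wt_ideal_times_gen: "x \<in> wt_ideal m \<Longrightarrow> x * gen g \<in> wt_ideal m"
proof (induction rule: wt_ideal_induct)
  case subspace
  show ?case
    by (simp add: falg.subspace_def wt_ideal_zero distrib_right wt_ideal_add scale_mult_left
        wt_ideal_scale)
next
  case (base w p n d)
  \<comment> \<open>This element is \<open>word w * p * gen g\<close>.\<close>
  have "word (w @ [g]) * p - word w * lie (gen g) p \<in> wt_ideal m"
    using base by (intro wt_ideal_diff wt_ideal_base word_times_lie_gen_pc_prod) auto
  moreover have "word (w @ [g]) * p = word w * gen g * p"
    by (simp only: word_append gen_def)
  ultimately show ?case
    by (simp add: lie_def algebra_simps)
qed

lemma ideal_wt_ideal: "ideal (wt_ideal m) A2"
  unfolding ideal_A2_iff
proof (intro conjI ballI allI)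
  fix x :: "'a falg" and a assume "x \<in> wt_ideal m"
  then show "a * x \<in> wt_ideal m"
    by (induction a arbitrary: x rule: falg_induct)
      (simp_all add: gen_times_wt_ideal distrib_right wt_ideal_add scale_mult_left wt_ideal_scale
        mult.assoc)
  show "x * a \<in> wt_ideal m"
    using \<open>x \<in> wt_ideal m\<close>
    by (induction a arbitrary: x rule: falg_induct)
      (simp_all add: wt_ideal_times_gen distrib_left wt_ideal_add mult_scale_right wt_ideal_scale
        flip: mult.assoc)
qed (simp_all add: wt_ideal_zero wt_ideal_add)

lemmas wt_ideal_mult_left = ideal_mult_left [OF ideal_wt_ideal]
  and wt_ideal_mult_right = ideal_mult_right [OF ideal_wt_ideal]

lemma wt_ideal_mult:
  assumes "x \<in> wt_ideal m" "y \<in> wt_ideal n"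
  shows "x * y \<in> wt_ideal (m + n)"
  using assms(2)
proof (induction rule: wt_ideal_induct)
  case subspace
  show ?case
    by (simp add: falg.subspace_def wt_ideal_zero distrib_left wt_ideal_add mult_scale_right
        wt_ideal_scale)
next
  case (base w q k e)
  have "z * q \<in> wt_ideal (m + n)" if "z \<in> wt_ideal m" for z
    using that
  proof (induction rule: wt_ideal_induct)
    case subspace
    show ?case
      by (simp add: falg.subspace_def wt_ideal_zero distrib_right wt_ideal_add scale_mult_left
          wt_ideal_scale)
  next
    case (base v p l d)
    have "word v * (p * q) \<in> wt_ideal (m + n)"
      using base \<open>n \<le> k\<close> by (intro wt_ideal_base [OF pc_prod_mult [OF _ \<open>pc_prod k e q\<close>]]) auto
    then show ?case by (simp add: mult.assoc)
  qed
  \<comment> \<open>The word between the factors is absorbed into \<open>x\<close> by right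
    multiplication.\<close>
  from this [of "x * word w"] show ?case
    using assms(1) by (simp add: wt_ideal_mult_right mult.assoc)
qed

lemma lie_in_wt_ideal_1:
  fixes a b :: "'k::field_char_0 falg"
  shows "lie a b \<in> wt_ideal (Suc 0)"
proof -
  note simps = lie_add_left lie_add_right lie_scale_left lie_scale_right lie_mult_left
    lie_mult_right wt_ideal_add wt_ideal_scale wt_ideal_mult_left wt_ideal_mult_right
  have gens: "lie (gen f) (gen g) \<in> (wt_ideal (Suc 0) :: 'k falg set)" for f g
    using pc_prod_in_wt_ideal [OF pc_prod.Cons [OF pc_prod.Nil, of "[]" f g], of "Suc 0"] by simp
  have "lie (gen f) b \<in> wt_ideal (Suc 0)" for f
  proof (induction b rule: falg_induct)
    case one
    show ?case by (simp add: lie_def wt_ideal_zero)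
  qed (simp_all add: simps gens)
  then show ?thesis
  proof (induction a rule: falg_induct)
    case one
    show ?case by (simp add: lie_1_left wt_ideal_zero)
  qed (simp_all add: simps)
qed

text \<open>On \<open>word w * p\<close>, bracketing the word yields a factor of weight one, and
  bracketing \<open>p\<close> raises its weight by one.\<close>

lemma lie_in_wt_ideal:
  assumes "x \<in> wt_ideal m"
  shows "lie a x \<in> wt_ideal (Suc m)"
proof (induction a rule: falg_induct)
  case (gen g)
  from assms show ?case
  proof (induction rule: wt_ideal_induct)
    case subspace
    show ?case
      by (simp add: falg.subspace_def wt_ideal_zero lie_0_right lie_add_right wt_ideal_add
          lie_scale_right wt_ideal_scale)
  next
    case (base w p n d)
    have "lie (gen g) (word w) * p \<in> wt_ideal (Suc 0 + m)"
      using base by (intro wt_ideal_mult lie_in_wt_ideal_1 pc_prod_in_wt_ideal)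
    moreover have "word w * lie (gen g) p \<in> wt_ideal (Suc m)"
      using base by (intro word_times_lie_gen_pc_prod) auto
    ultimately show ?case by (simp add: lie_mult_right wt_ideal_add)
  qed
qed (simp_all add: lie_1_left wt_ideal_zero lie_add_left wt_ideal_add lie_scale_left
    wt_ideal_scale lie_mult_left wt_ideal_mult_left wt_ideal_mult_right)

lemma M_subset_wt_ideal: "M (Suc m) \<subseteq> wt_ideal m"
proof -
  have "x \<in> wt_ideal m" if "x \<in> L (Suc m)" for x :: "'a falg"
    using that
  proof (induction m arbitrary: x)
    case 0
    \<comment> \<open>The empty product \<open>1\<close> has weight zero, so
      \<open>wt_ideal 0\<close> is everything.\<close>
    have "x * 1 \<in> wt_ideal 0"
      by (intro wt_ideal_mult_left pc_prod_in_wt_ideal [OF pc_prod.Nil]) simp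
    then show ?case by simp
  next
    case (Suc m)
    from Suc.prems show ?case
      by (induction rule: L_Suc_induct)
        (auto simp: wt_ideal_zero wt_ideal_add wt_ideal_scale intro: lie_in_wt_ideal Suc.IH)
  qed
  then show ?thesis
    by (intro M_minimal ideal_wt_ideal) blast
qed

section \<open>Lowering the weight and the degree\<close>

text \<open>
  With \<open>c = [a, b]\<close>, the product \<open>c r\<close> equals \<open>[a, b r] - b [a, r]\<close>. The first term lies in the
  ideal of \<open>b r\<close>, of smaller weight and degree; in the second, the first factor is shorter.
\<close>

lemma pc_prod_in_ideal_step:
  fixes p :: "'k::field_char_0 falg"
  assumes J: "ideal J A2" and low: "\<And>e q. e < d \<Longrightarrow> pc_prod n e q \<Longrightarrow> q \<in> J"
    and "pc_prod (Suc n) e p" "e \<le> d"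
  shows "p \<in> J"
proof -
  have main: "comm (a # b # js) * r \<in> J"
    if "pc_prod k e r" "n = length js + k" "Suc (Suc (length js)) + e \<le> d" for a b js k e r
    using that
  proof (induction js arbitrary: a b k e r)
    case Nil
    \<comment> \<open>A leading commutator of length two is dropped whole: \<open>r\<close> has
      weight \<open>n\<close> and degree below \<open>d\<close>.\<close>
    then show ?case using low [of e r] by (intro ideal_mult_left [OF J]) simp
  next
    case (Cons c js)
    let ?b = "comm (b # c # js)"
    have "pc_prod n (Suc (Suc (length js)) + e) (?b * r)"
      using pc_prod.Cons [OF Cons.prems(1), of js b c] Cons.prems(2) by simp
    then have "?b * r \<in> J"
      by (rule low [rotated]) (use Cons.prems(3) in simp)
    then have 1: "lie (gen a) (?b * r) \<in> J"
      unfolding lie_def by (blast intro: ideal_diff [OF J] ideal_mult_left [OF J] ideal_mult_right [OF J])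
    \<comment> \<open>The first factor loses one letter while \<open>r\<close> gains one, so total
      weight and degree are preserved.\<close>
    have 2: "?b * lie (gen a) r \<in> J"
      using lie_gen_pc_prod [OF Cons.prems(1)] subspace_ideal [OF J]
    proof (rule mult_span_left)
      fix q :: "'k falg" assume "q \<in> {q. pc_prod (Suc k) (Suc e) q}"
      then show "?b * q \<in> J"
        using Cons.prems(2,3) by (intro Cons.IH [of "Suc k" "Suc e"]) simp_all
    qed
    from ideal_diff [OF J 1 2] show ?case by (simp add: lie_mult_right)
  qed
  from assms(3) show ?thesis
  proof cases
    case (Cons k e' r js a b)
    show ?thesis
      unfolding Cons(3) by (rule main [OF Cons(4)]) (use Cons(1,2) assms(4) in simp_all)
  qed
qed

text \<open>Iterates the step, removing one unit of weight each time; products of intermediate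
  weight enter only in degrees below \<open>d\<close>.\<close>

lemma pc_prod_in_ideal:
  assumes J: "ideal J A2" and low: "\<And>e q. e < d \<Longrightarrow> pc_prod n e q \<Longrightarrow> q \<in> J"
    and "pc_prod (Suc n + k) e p" "e \<le> d"
  shows "p \<in> J"
  using assms(3,4)
proof (induction k arbitrary: e p)
  case 0
  show ?case
    by (rule pc_prod_in_ideal_step [OF J low, where e = e]) (use 0 in simp_all)
next
  case (Suc k)
  have low': "q \<in> J" if "e < d" "pc_prod (Suc n + k) e q" for e q
    using that by (intro Suc.IH) auto
  show ?case
    by (rule pc_prod_in_ideal_step [OF J low', where e = e]) (use Suc.prems in simp_all)
qed

section \<open>Homogeneity in the word length\<close>

definition homogeneous :: "nat \<Rightarrow> 'k::field_char_0 falg \<Rightarrow> bool" where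
  "homogeneous d p \<longleftrightarrow> (\<forall>w. length w \<noteq> d \<longrightarrow> Poly_Mapping.lookup p (Mon w) = 0)"

lemma homogeneous_word: "homogeneous (length w) (word w)"
  by (simp add: homogeneous_def lookup_single when_def)

lemma homogeneous_gen: "homogeneous (Suc 0) (gen g)"
  using homogeneous_word [of "[g]"] by (simp add: gen_def)

lemma homogeneous_mult:
  assumes "homogeneous d p" "homogeneous e q"
  shows "homogeneous (d + e) (p * q)"
proof -
  have "length w = d + e" if w: "Mon w \<in> Poly_Mapping.keys (p * q)" for w
  proof -
    obtain s t where st: "Mon w = s + t" "s \<in> Poly_Mapping.keys p" "t \<in> Poly_Mapping.keys q"
      using w keys_mult [of p q] by blast
    obtain u v where "s = Mon u" "t = Mon v"
      by (cases s, cases t) blast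
    with st show ?thesis
      using assms by (auto simp: homogeneous_def in_keys_iff)
  qed
  then show ?thesis
    unfolding homogeneous_def in_keys_iff by blast
qed

lemma homogeneous_diff: "homogeneous d p \<Longrightarrow> homogeneous d q \<Longrightarrow> homogeneous d (p - q)"
  by (simp add: homogeneous_def lookup_minus)

lemma homogeneous_comm: "homogeneous (Suc (length js)) (comm (a # js))"
proof (induction js arbitrary: a)
  case (Cons b js)
  from homogeneous_mult [OF homogeneous_gen Cons.IH] homogeneous_mult [OF Cons.IH homogeneous_gen]
  show ?case by (auto simp: lie_def intro: homogeneous_diff)
qed (simp add: homogeneous_gen)

lemma homogeneous_pc_prod: "pc_prod n d p \<Longrightarrow> homogeneous d p"
proof (induction rule: pc_prod.induct)
  case Nil
  show ?case using homogeneous_word [of "[]"] by (simp add: word_Nil)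
next
  case (Cons n d p js a b)
  from homogeneous_mult [OF homogeneous_comm Cons.IH, of "b # js" a] show ?case by simp
qed

text \<open>Only terms \<open>word w * q\<close> of total degree \<open>d\<close> contribute to the
  component of degree \<open>d\<close>, and there \<open>q\<close> has degree at most
  \<open>d\<close>. Terms of other degrees in a spanning expression cancel.\<close>

lemma homogeneous_wt_ideal:
  assumes J: "ideal J A2" and low: "\<And>n e q. pc_prod n e q \<Longrightarrow> m \<le> n \<Longrightarrow> e \<le> d \<Longrightarrow> q \<in> J"
    and x: "x \<in> wt_ideal m" and hom: "homogeneous d x"
  shows "x \<in> J"
proof -
  \<comment> \<open>\<open>?P x\<close> says that the component of \<open>x\<close> of degree
    \<open>d\<close> lies in \<open>J\<close>.\<close>
  let ?P = "\<lambda>x. \<exists>y\<in>J. \<forall>w. Poly_Mapping.lookup y (Mon w) =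
    (if length w = d then Poly_Mapping.lookup x (Mon w) else 0)"
  have "?P x"
    using x
  proof (induction rule: wt_ideal_induct)
    case subspace
    show ?case
      unfolding falg.subspace_def mem_Collect_eq
    proof (intro conjI allI impI ballI)
      show "?P 0"
        by (rule bexI [OF _ ideal_zero [OF J]]) simp
    next
      fix x y assume "x \<in> {x. ?P x}" "y \<in> {x. ?P x}"
      then obtain x' y' where "x' \<in> J" "y' \<in> J"
        and "\<forall>w. Poly_Mapping.lookup x' (Mon w) =
          (if length w = d then Poly_Mapping.lookup x (Mon w) else 0)"
        and "\<forall>w. Poly_Mapping.lookup y' (Mon w) =
          (if length w = d then Poly_Mapping.lookup y (Mon w) else 0)"
        by blast
      then show "?P (x + y)"
        by (intro bexI [OF _ ideal_add [OF J, of x' y']]) (simp_all add: lookup_add)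
    next
      fix c x assume "x \<in> {x. ?P x}"
      then obtain x' where "x' \<in> J"
        and "\<forall>w. Poly_Mapping.lookup x' (Mon w) =
          (if length w = d then Poly_Mapping.lookup x (Mon w) else 0)"
        by blast
      then show "?P (scale c x)"
        by (intro bexI [OF _ ideal_scale [OF J, of x' c]])
          (simp_all add: scale_def map.rep_eq when_def)
    qed
  next
    case (base w q n e)
    have hom: "homogeneous (length w + e) (word w * q)"
      using base by (intro homogeneous_mult homogeneous_word homogeneous_pc_prod)
    show ?case
    proof (cases "length w + e = d")
      case True
      with base low have "word w * q \<in> J"
        by (intro ideal_mult_left [OF J]) simp
      then show ?thesis
        by (rule bexI [rotated]) (use hom True in \<open>auto simp: homogeneous_def\<close>)
    next
      case False
      with hom show ?thesis
        by (intro bexI [OF _ ideal_zero [OF J]]) (auto simp: homogeneous_def)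
    qed
  qed
  then obtain y where y: "y \<in> J" "\<And>w. Poly_Mapping.lookup y (Mon w) =
    (if length w = d then Poly_Mapping.lookup x (Mon w) else 0)"
    by blast
  have "y = x"
  proof (rule poly_mapping_eqI)
    fix k show "Poly_Mapping.lookup y k = Poly_Mapping.lookup x k"
      using hom by (cases k) (auto simp: y(2) homogeneous_def)
  qed
  with y(1) show ?thesis by simp
qed

section \<open>Generation by the products of maximal inclusion\<close>

lemma pc_prod_in_S:
  assumes p: "pc_prod (Suc m) d p" and "p \<noteq> 0" and "p \<notin> M (Suc (Suc (Suc m)))"
  shows "p \<in> S (Suc (Suc m))"
proof -
  obtain cs where cs: "p = prod_list cs" "set cs \<subseteq> {comm js | js. 2 \<le> length js}" "cs \<noteq> []"
    by (rule pc_prod_factors [OF p]) simp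
  \<comment> \<open>\<open>pc_prod\<close> allows zero commutators, whereas
    \<open>pure_commutators\<close> does not.\<close>
  have "0 \<notin> set cs"
    using \<open>p \<noteq> 0\<close> cs(1) prod_list_zero by blast
  have "set cs \<subseteq> (\<Union>m\<in>{2..}. pure_commutators m)"
  proof
    fix c assume "c \<in> set cs"
    with cs(2) obtain js where "c = comm js" "2 \<le> length js" by blast
    with \<open>c \<in> set cs\<close> \<open>0 \<notin> set cs\<close> show "c \<in> (\<Union>m\<in>{2..}. pure_commutators m)"
      by (intro UN_I [of "length js"]) (auto simp: pure_commutators_def)
  qed
  moreover have "max_inclusion (Suc (Suc m)) p"
    using pc_prod_in_M [OF p] assms(3) by (simp add: max_inclusion_def)
  ultimately show ?thesis
    unfolding S_def mem_Collect_eq using cs(1,3) \<open>p \<noteq> 0\<close> by (intro exI [of _ cs]) simp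
qed

text \<open>
  Induction on the degree: a product that fails to be in \<open>S\<close> because it lies deeper in the
  filtration is generated by products of the same weight and smaller degree.
\<close>

lemma pc_prod_in_Idl_S:
  fixes p :: "'k::field_char_0 falg"
  assumes "pc_prod (Suc m) d p"
  shows "p \<in> Idl\<^bsub>A2\<^esub> (S (Suc (Suc m)))"
  using assms
proof (induction d arbitrary: p rule: less_induct)
  case (less d)
  let ?J = "Idl\<^bsub>A2\<^esub> (S (Suc (Suc m))) :: 'k falg set"
  have J: "ideal ?J A2" by (rule ideal_Idl_A2)
  consider "p = 0" | "p \<noteq> 0" "p \<notin> M (Suc (Suc (Suc m)))" | "p \<in> M (Suc (Suc (Suc m)))"
    by blast
  then show ?case
  proof cases
    case 1
    then show ?thesis using ideal_zero [OF J] by simp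
  next
    case 2
    then show ?thesis using pc_prod_in_S [OF less.prems] Idl_A2_self by blast
  next
    case 3
    \<comment> \<open>Lying deeper, \<open>p\<close> is built from products of weight at least
      \<open>m + 2\<close> and degree at most \<open>d\<close>; these reduce to weight
      \<open>m + 1\<close> and degree below \<open>d\<close>, where the induction hypothesis
      applies.\<close>
    have "q \<in> ?J" if q: "pc_prod n e q" "Suc (Suc m) \<le> n" "e \<le> d" for n e and q :: "'k falg"
    proof -
      obtain k where "n = Suc (Suc m) + k"
        using q(2) le_Suc_ex by blast
      then have "pc_prod (Suc (Suc m) + k) e q"
        using q(1) by simp
      from pc_prod_in_ideal [OF J less.IH this q(3)] show ?thesis .
    qed
    moreover have "p \<in> wt_ideal (Suc (Suc m))"
      using 3 M_subset_wt_ideal by blast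
    ultimately show ?thesis
      using homogeneous_pc_prod [OF less.prems] by (rule homogeneous_wt_ideal [OF J])
  qed
qed

lemma M_eq_Idl_S:
  assumes "i \<ge> 2"
  shows "(M i :: 'k::field_char_0 falg set) = Idl\<^bsub>A2\<^esub> (S i)"
proof
  show "Idl\<^bsub>A2\<^esub> (S i) \<subseteq> (M i :: 'k falg set)"
    by (rule Idl_A2_minimal [OF ideal_M]) (auto simp: S_def max_inclusion_def)
  obtain m where "i = 2 + m"
    using assms le_Suc_ex by blast
  then have i: "i = Suc (Suc m)" by simp
  let ?J = "Idl\<^bsub>A2\<^esub> (S i) :: 'k falg set"
  have J: "ideal ?J A2" by (rule ideal_Idl_A2)
  have "q \<in> ?J" if q: "pc_prod n e q" "Suc m \<le> n" for n e and q :: "'k falg"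
  proof (cases "n = Suc m")
    case True
    then show ?thesis using q pc_prod_in_Idl_S i by blast
  next
    case False
    with q(2) have "Suc (Suc m) \<le> n" by simp
    then obtain k where "n = Suc (Suc m) + k"
      using le_Suc_ex by blast
    then have "pc_prod (Suc (Suc m) + k) e q"
      using q(1) by simp
    \<comment> \<open>The degree bound is \<open>e\<close> itself, since products of weight
      \<open>m + 1\<close> are now known to lie in \<open>?J\<close> in every degree.\<close>
    from pc_prod_in_ideal [OF J _ this order_refl] show ?thesis
      using pc_prod_in_Idl_S i by blast
  qed
  note gens = this
  have "x \<in> ?J" if "x \<in> wt_ideal (Suc m)" for x
    using that
  proof (induction rule: wt_ideal_induct)
    case subspace
    show ?case using subspace_ideal [OF J] by simp
  next
    case (base w p n d)
    then show ?case by (intro ideal_mult_left [OF J] gens)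
  qed
  then show "M i \<subseteq> ?J"
    using M_subset_wt_ideal unfolding i by blast
qed

lemma vs_isomorphic_refl: "vs_isomorphic V V"
  unfolding vs_isomorphic_def by (rule bexI [of _ id]) (auto simp: iso_def hom_def bij_betw_def)

theorem theorem3p6:
  fixes i :: nat
  assumes "i \<ge> 2"
  shows "(M i :: 'k::field_char_0 falg set) = Idl\<^bsub>A2\<^esub> (S i)
    \<and> vs_isomorphic (Q i :: ('k, 'k falg set) module) (quot_alg A2 (Idl\<^bsub>A2\<^esub> (S i)))"
  \<comment> \<open>The ideals coincide, so the two quotients are equal and the identity is the
    isomorphism.\<close>
  using M_eq_Idl_S [OF assms, where 'k = 'k] by (simp add: Q_def vs_isomorphic_refl)

end
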